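(* Let $m,n,k$ be positive integers with $k<\min\{m,n\}$, and let $\mathcal{M}(W_1,W_2)=W_1W_2$ denote the matrix multiplication mapping with $W_1\in\mathbb{R}^{m\times k}$ and $W_2\in\mathbb{R}^{k\times n}$. Let $\bar W_1\in\mathbb{R}^{m\times k}$ and $\bar W_2\in\mathbb{R}^{k\times n}$. If $\operatorname{rank}(\bar W_1)\neq\operatorname{rank}(\bar W_2)$, then $\mathcal{M}$ is not locally open at $(\bar W_1,\bar W_2)$. If $\operatorname{rank}(\bar W_1)=\operatorname{rank}(\bar W_2)$, then the following statements are equivalent: (i) there exists $\widetilde W_1\in\mathbb{R}^{m\times k}$ such that $\widetilde W_1\bar W_2=0$ and $\bar W_1+\widetilde W_1$ has full column rank; (ii) there exists $\widetilde W_2\in\mathbb{R}^{k\times n}$ such that $\bar W_1\widetilde W_2=0$ and $\bar W_2+\widetilde W_2$ has full row rank; (iii) $\dim\big(\mathcal{N}(\bar W_1)\cap\mathcal{C}(\bar W_2)\big)=0$; (iv) $\dim\big(\mathcal{N}(\bar W_2^{\top})\cap\mathcal{C}(\bar W_1^{\top})\big)=0$; (v) $\mathcal{M}$ is locally open at $(\bar W_1,\bar W_2)$ in its range $\mathcal{R}_{\mathcal{M}}$.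
   Context: $\mathcal{N}(A)$ and $\mathcal{C}(A)$ denote the null space and column space of a matrix $A$. The range of $\mathcal{M}:\mathbb{R}^{m\times k}\times\mathbb{R}^{k\times n}\to\mathcal{R}_{\mathcal{M}}$ is $\mathcal{R}_{\mathcal{M}}=\{Z\in\mathbb{R}^{m\times n}:\operatorname{rank}(Z)\le\min(m,n,k)\}$. A mapping $\mathcal{F}$ is locally open at a point $w$ if for every $\epsilon>0$ there exists $\delta>0$ such that $B_\delta(\mathcal{F}(w))\cap\mathcal{R}_{\mathcal{F}}\subseteq\mathcal{F}(B_\epsilon(w))$, where $\mathcal{R}_{\mathcal{F}}$ is the range of $\mathcal{F}$ and $B_\epsilon(w)$, $B_\delta(\mathcal{F}(w))$ are balls of the indicated radius and center (local openness is always understood relative to the range); matrices carry the Frobenius norm. *)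

theory Defs
  imports "HOL-Analysis.Analysis"
begin

text \<open>Local openness is relative to the range of the mapping, not to the whole codomain.\<close>

definition locally_open_at :: "('a::metric_space \<Rightarrow> 'b::metric_space) \<Rightarrow> 'a \<Rightarrow> bool" where
  "locally_open_at F w \<longleftrightarrow>
     (\<forall>\<epsilon>>0. \<exists>\<delta>>0. ball (F w) \<delta> \<inter> range F \<subseteq> F ` ball w \<epsilon>)"

definition mat_mult_map :: "(real^'k^'m) \<times> (real^'n^'k) \<Rightarrow> real^'n^'m" where
  "mat_mult_map = (\<lambda>(W1, W2). W1 ** W2)"

definition null_space :: "real^'n^'m \<Rightarrow> (real^'n) set" where
  "null_space A = {x. A *v x = 0}"

definition column_space :: "real^'n^'m \<Rightarrow> (real^'m) set" where
  "column_space A = span (columns A)"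

definition full_column_rank :: "real^'n^'m \<Rightarrow> bool" where
  "full_column_rank A \<longleftrightarrow> rank A = CARD('n)"

definition full_row_rank :: "real^'n^'m \<Rightarrow> bool" where
  "full_row_rank A \<longleftrightarrow> rank A = CARD('m)"

text \<open>The library norm on matrices is the Frobenius norm.  Pairs of matrices carry the
  corresponding Euclidean product norm (\<open>norm_Pair\<close>), i.e. the Frobenius norm of all
  entries of both factors.\<close>

lemma norm_matrix_frobenius:
  fixes A :: "real^'n^'m"
  shows "norm A = sqrt (\<Sum>i\<in>UNIV. \<Sum>j\<in>UNIV. (A $ i $ j)\<^sup>2)"
  by (simp add: norm_vec_def L2_set_def sum_nonneg)

lemma range_mat_mult_map:
  "range (mat_mult_map :: (real^'k^'m) \<times> (real^'n^'k) \<Rightarrow> real^'n^'m)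
     = {Z. rank Z \<le> min (CARD('m)) (min (CARD('n)) (CARD('k)))}"
proof (intro equalityI subsetI)
  fix Z :: "real^'n^'m"
  assume "Z \<in> range (mat_mult_map :: (real^'k^'m) \<times> (real^'n^'k) \<Rightarrow> real^'n^'m)"
  then obtain A :: "real^'k^'m" and B :: "real^'n^'k" where Z: "Z = A ** B"
    by (auto simp: mat_mult_map_def)
  have "rank Z \<le> rank A" unfolding Z by (rule rank_mul_le_left)
  then show "Z \<in> {Z. rank Z \<le> min (CARD('m)) (min (CARD('n)) (CARD('k)))}"
    using rank_bound[of Z] rank_bound[of A] by simp
next
  fix Z :: "real^'n^'m"
  assume "Z \<in> {Z. rank Z \<le> min (CARD('m)) (min (CARD('n)) (CARD('k)))}"
  then have rk: "dim (columns Z) \<le> CARD('k)"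
    by (simp add: column_rank_def)
  obtain S where S: "columns Z \<subseteq> span S" "independent S" "card S = dim (columns Z)"
    using basis_exists by metis
  have fin: "finite S" using S(2) by (rule independent_imp_finite)
  obtain g :: "real^'m \<Rightarrow> 'k" where g: "inj_on g S"
    using card_le_inj[OF fin, of "UNIV :: 'k set"] rk S(3) by auto
  define f where "f = inv_into S g"
  define A :: "real^'k^'m" where "A = (\<chi> i l. f l $ i)"
  have col: "column l A = f l" for l
    by (simp add: column_def A_def vec_eq_iff)
  have "S \<subseteq> columns A"
  proof
    fix x assume "x \<in> S"
    then have "x = column (g x) A" by (simp add: col f_def g)
    then show "x \<in> columns A" by (auto simp: columns_def)
  qed
  then have "columns Z \<subseteq> span (columns A)"
    using S(1) span_mono by blast
  moreover have "span (columns A) \<subseteq> range ((*v) A)"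
  proof (rule span_minimal)
    show "columns A \<subseteq> range ((*v) A)"
      by (auto simp: columns_def simp flip: matrix_vector_mult_basis)
    show "subspace (range ((*v) A))"
      by (simp add: linear_subspace_image subspace_UNIV)
  qed
  ultimately have "\<forall>j. \<exists>w. column j Z = A *v w"
    unfolding columns_def by blast
  then obtain w where w: "\<And>j. column j Z = A *v w j" by metis
  define B :: "real^'n^'k" where "B = (\<chi> l j. w j $ l)"
  have "A ** B = Z"
    using w by (simp add: vec_eq_iff matrix_matrix_mult_def matrix_vector_mult_def B_def column_def)
  then have "mat_mult_map (A, B) = Z" by (simp add: mat_mult_map_def)
  then show "Z \<in> range (mat_mult_map :: (real^'k^'m) \<times> (real^'n^'k) \<Rightarrow> real^'n^'m)"
    by (metis rangeI)
qed

end

theory Submission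
  imports Defs
begin

text \<open>
  Let \<open>A = W1 ** W2\<close>.  Everything is governed by whether forming the product loses rank.
  Condition (iii), \<open>N(W1) \<inter> C(W2) = {0}\<close>, says that \<open>W1\<close> kills nothing of the column space
  of \<open>W2\<close>, that is \<open>rank A = rank W2\<close>; (iv) is its transpose, \<open>rank A = rank W1\<close>.  Both are read
  off from rank-nullity (\<open>rank_mult_eq_right_iff_disjoint\<close>, \<open>rank_mult_eq_left_iff_disjoint\<close>), and
  for \<open>rank W1 = rank W2\<close> they visibly coincide.  Condition (i) is equivalent to (iii)
  (\<open>full_column_rank_correction_iff\<close>): a correction that vanishes on \<open>C(W2)\<close> may repair the kernel
  of \<open>W1\<close> exactly if that kernel is in direct sum with \<open>C(W2)\<close>, and there is room because
  \<open>m \<ge> k\<close>.  Condition (ii) is the transpose of (i).  So the theorem follows once local openness is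
  shown to mean \<open>rank A = rank W1 \<and> rank A = rank W2\<close>.

  Necessity (\<open>locally_open_at_imp_rank_product_eq_right\<close>).  If \<open>rank A < rank W2\<close>, there is a \<open>y\<close>
  with \<open>A y = 0\<close> and \<open>W2 y \<noteq> 0\<close>.  Since \<open>k < n\<close>, there are \<open>Z\<close> arbitrarily near \<open>A\<close> of rank exactly
  \<open>k\<close> that still kill \<open>y\<close>.  If \<open>Z = X ** Y\<close> with \<open>Y\<close> near \<open>W2\<close>, then \<open>Y y \<noteq> 0\<close> lies in the kernel
  of \<open>X\<close>, so \<open>rank X < k\<close>, contradicting \<open>rank Z = k\<close>.  Transposition (using \<open>k < m\<close>)
  gives \<open>rank A = rank W1\<close>.

  Sufficiency (\<open>rank_product_eq_imp_locally_open_at\<close>).  Let \<open>A ** G ** A = A\<close> and put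
  \<open>L = W2 ** G\<close>, \<open>R = G ** W1\<close>, \<open>E = W2 ** G ** W1\<close>.  The rank condition makes \<open>E\<close> the projection
  onto \<open>C(W2)\<close> along \<open>N(W1)\<close>, so \<open>R\<^sup>k\<close> splits into a part that carries \<open>A\<close> and a part
  of dimension \<open>k - rank A\<close> that the product does not see.  For \<open>Z\<close> near \<open>A\<close> the matrix
  \<open>D = L ** Z ** R + (1 - E)\<close> is near the identity; with its inverse \<open>D'\<close>, the factors
  \<open>Z ** R ** D'\<close> and \<open>L ** Z\<close> are near \<open>W1\<close> and \<open>W2\<close>, and their product misses \<open>Z\<close> by the Schur
  complement \<open>S = Z - Z ** R ** D' ** L ** Z\<close>.  Its rank is at most \<open>rank Z - rank E\<close>, so if
  \<open>rank Z \<le> k\<close> it can be factored through the free part \<open>N(E)\<close>; it is small, so balancing its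
  norm between the two factors keeps both additions small, and as they live on complementary parts of
  \<open>R\<^sup>k\<close> there are no cross terms.
\<close>

section \<open>Matrix products, ranks and partial isometries\<close>

lemma bounded_bilinear_matrix_mult:
  "bounded_bilinear ((**) :: real^'n^'m \<Rightarrow> real^'p^'n \<Rightarrow> real^'p^'m)"
proof -
  have "bilinear ((**) :: real^'n^'m \<Rightarrow> real^'p^'n \<Rightarrow> real^'p^'m)"
    unfolding bilinear_def
    by (auto intro!: linearI simp: vec_eq_iff matrix_matrix_mult_def sum_distrib_left
        algebra_simps sum.distrib)
  then show ?thesis
    by (simp add: bilinear_conv_bounded_bilinear)
qed

lemmas matrix_diff_rdistrib = bounded_bilinear.diff_left[OF bounded_bilinear_matrix_mult]
lemmas matrix_diff_ldistrib = bounded_bilinear.diff_right[OF bounded_bilinear_matrix_mult]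
lemmas matrix_scaleR_left = bounded_bilinear.scaleR_left[OF bounded_bilinear_matrix_mult]
lemmas matrix_scaleR_right = bounded_bilinear.scaleR_right[OF bounded_bilinear_matrix_mult]
lemmas matrix_zero_left = bounded_bilinear.zero_left[OF bounded_bilinear_matrix_mult]
lemmas matrix_zero_right = bounded_bilinear.zero_right[OF bounded_bilinear_matrix_mult]
lemmas tendsto_matrix_mult = bounded_bilinear.tendsto[OF bounded_bilinear_matrix_mult]

lemma bounded_bilinear_matrix_vector_mult:
  "bounded_bilinear ((*v) :: real^'n^'m \<Rightarrow> real^'n \<Rightarrow> real^'m)"
proof -
  have "bilinear ((*v) :: real^'n^'m \<Rightarrow> real^'n \<Rightarrow> real^'m)"
    unfolding bilinear_def
    by (auto intro!: linearI simp: algebra_simps)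
       (auto simp: vec_eq_iff matrix_vector_mult_def sum_distrib_left algebra_simps)
  then show ?thesis
    by (simp add: bilinear_conv_bounded_bilinear)
qed

lemma norm_transpose: "norm (transpose A) = norm A" for A :: "real^'n^'m"
  unfolding norm_matrix_frobenius by (subst sum.swap) (simp add: transpose_def)

lemma transpose_add: "transpose (A + B) = transpose A + transpose B" for A B :: "real^'n^'m"
  by (simp add: transpose_def vec_eq_iff)

lemma transpose_diff: "transpose (A - B) = transpose A - transpose B" for A B :: "real^'n^'m"
  by (simp add: transpose_def vec_eq_iff)

lemma transpose_zero: "transpose (0 :: real^'n^'m) = 0"
  by (simp add: transpose_def vec_eq_iff)

definition outer :: "real^'m \<Rightarrow> real^'n \<Rightarrow> real^'n^'m" where
  "outer u v = (\<chi> i j. u $ i * v $ j)"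

lemma outer_vector_mult: "outer u v *v x = (v \<bullet> x) *\<^sub>R u"
  by (simp add: outer_def vec_eq_iff matrix_vector_mult_def inner_vec_def sum_distrib_left
      sum_distrib_right ac_simps)

lemma transpose_outer: "transpose (outer u v) = outer v u"
  by (simp add: outer_def transpose_def vec_eq_iff ac_simps)

lemma norm_outer: "norm (outer u v) = norm u * norm v"
proof -
  have "norm (outer u v) = sqrt (\<Sum>i\<in>UNIV. \<Sum>j\<in>UNIV. (u $ i)\<^sup>2 * (v $ j)\<^sup>2)"
    by (simp add: norm_matrix_frobenius outer_def power_mult_distrib)
  also have "\<dots> = sqrt ((\<Sum>i\<in>UNIV. (u $ i)\<^sup>2) * (\<Sum>j\<in>UNIV. (v $ j)\<^sup>2))"
    by (simp add: sum_product)
  finally show ?thesis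
    by (simp add: norm_vec_def L2_set_def real_sqrt_mult)
qed

lemma column_space_eq_range: "column_space A = range ((*v) A)"
  unfolding column_space_def
proof (rule antisym)
  show "span (columns A) \<subseteq> range ((*v) A)"
    by (rule span_minimal)
      (auto simp: columns_def linear_subspace_image simp flip: matrix_vector_mult_basis)
  show "range ((*v) A) \<subseteq> span (columns A)"
    by (auto intro: matrix_vector_mult_in_columnspace)
qed

lemma subspace_column_space: "subspace (column_space A)"
  by (simp add: column_space_def)

lemma dim_column_space: "dim (column_space A) = rank A"
  by (simp add: column_space_eq_range rank_dim_range)

lemma subspace_null_space: "subspace (null_space A)" for A :: "real^'n^'m"
  unfolding null_space_def subspace_def by (simp add: algebra_simps)

lemma dim_null_space: "dim (null_space A) + rank A = CARD('n)" for A :: "real^'n^'m"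
proof -
  have row_nth: "row i A = A $ i" for i
    by (simp add: row_def)
  have "null_space A = {y \<in> UNIV. \<forall>x \<in> span (rows A). orthogonal x y}"
  proof (intro equalityI subsetI)
    fix y assume "y \<in> null_space A"
    then have "A $ i \<bullet> y = 0" for i
      by (simp add: null_space_def matrix_mult_dot vec_eq_iff)
    then have "orthogonal y x" if "x \<in> rows A" for x
      using that by (auto simp: rows_def row_nth orthogonal_def inner_commute)
    then show "y \<in> {y \<in> UNIV. \<forall>x \<in> span (rows A). orthogonal x y}"
      using orthogonal_to_span orthogonal_commute by blast
  next
    fix y assume y: "y \<in> {y \<in> UNIV. \<forall>x \<in> span (rows A). orthogonal x y}"
    have "orthogonal (row i A) y" for i
      using y span_base[of "row i A" "rows A"] by (auto simp: rows_def)
    then show "y \<in> null_space A"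
      by (simp add: null_space_def matrix_mult_dot vec_eq_iff orthogonal_def row_def)
  qed
  then show ?thesis
    using dim_subspace_orthogonal_to_vectors[of "span (rows A)" UNIV]
    by (simp add: row_rank_def[symmetric])
qed

text \<open>On the column space of \<open>A\<close>, \<open>G\<close> picks preimages.\<close>
lemma matrix_generalized_inverse:
  fixes A :: "real^'n^'m"
  obtains G :: "real^'m^'n" where "A ** G ** A = A"
proof -
  obtain g where g: "linear g" "\<forall>v\<in>range ((*v) A). A *v g v = v"
    using linear_exists_right_inverse_on[of "(*v) A" UNIV] by auto
  have "A ** matrix g ** A = A"
    using g by (simp add: matrix_eq matrix_works flip: matrix_vector_mul_assoc)
  then show ?thesis by (rule that)
qed

text \<open>The null space can only grow on multiplying from the left, and rank-nullity compares its
  dimension before and after.\<close>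
lemma rank_mult_eq_right_iff:
  fixes A :: "real^'k^'m" and B :: "real^'n^'k"
  shows "rank (A ** B) = rank B \<longleftrightarrow> null_space (A ** B) = null_space B"
proof
  assume "rank (A ** B) = rank B"
  then have "dim (null_space (A ** B)) = dim (null_space B)"
    using dim_null_space[of B] dim_null_space[of "A ** B"] by simp
  moreover have "null_space B \<subseteq> null_space (A ** B)"
    by (auto simp: null_space_def simp flip: matrix_vector_mul_assoc)
  ultimately show "null_space (A ** B) = null_space B"
    by (metis subspace_dim_equal subspace_null_space order_refl)
next
  assume "null_space (A ** B) = null_space B"
  then show "rank (A ** B) = rank B"
    using dim_null_space[of B] dim_null_space[of "A ** B"] by simp
qed

lemma rank_mult_eq_right_iff_disjoint:
  fixes A :: "real^'k^'m" and B :: "real^'n^'k"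
  shows "dim (null_space A \<inter> column_space B) = 0 \<longleftrightarrow> rank (A ** B) = rank B"
proof -
  have "null_space A \<inter> column_space B \<subseteq> {0} \<longleftrightarrow> (\<forall>y. A *v (B *v y) = 0 \<longrightarrow> B *v y = 0)"
    by (auto simp: null_space_def column_space_eq_range)
  also have "\<dots> \<longleftrightarrow> null_space (A ** B) = null_space B"
    by (auto simp: null_space_def simp flip: matrix_vector_mul_assoc)
  finally show ?thesis
    by (simp add: rank_mult_eq_right_iff)
qed

lemma rank_mult_eq_left_iff_disjoint:
  fixes A :: "real^'k^'m" and B :: "real^'n^'k"
  shows "dim (null_space (transpose B) \<inter> column_space (transpose A)) = 0 \<longleftrightarrow> rank (A ** B) = rank A"
  by (metis rank_mult_eq_right_iff_disjoint matrix_transpose_mul rank_transpose)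

text \<open>Where no rank is lost, \<open>A\<close> is injective on the column space of \<open>B\<close> and so may be cancelled.
  Together with a generalized inverse \<open>G\<close> of \<open>A ** B\<close> this turns \<open>A ** B ** G ** A ** B = A ** B\<close>
  into \<open>B ** G ** A ** B = B\<close>.\<close>
lemma matrix_cancel_left_factor:
  fixes A :: "real^'k^'m" and B :: "real^'n^'k"
  assumes "rank (A ** B) = rank B" and "A ** B ** X = A ** B"
  shows "B ** X = B"
proof -
  have "X *v x - x \<in> null_space (A ** B)" for x
    using assms(2) by (simp add: null_space_def matrix_vector_mult_diff_distrib matrix_vector_mul_assoc)
  then have "X *v x - x \<in> null_space B" for x
    using assms(1) by (simp add: rank_mult_eq_right_iff)
  then show ?thesis
    by (simp add: null_space_def matrix_vector_mult_diff_distrib matrix_eq matrix_vector_mul_assoc)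
qed

lemma matrix_cancel_right_factor:
  fixes A :: "real^'k^'m" and B :: "real^'n^'k"
  assumes "rank (A ** B) = rank A" and "X ** (A ** B) = A ** B"
  shows "X ** A = A"
  by (metis assms matrix_cancel_left_factor[of "transpose B" "transpose A" "transpose X"]
      matrix_transpose_mul rank_transpose transpose_iff)

text \<open>Match an orthonormal basis of \<open>U\<close> with orthonormal vectors of \<open>T\<close>; the transpose of the
  resulting map undoes it on \<open>U\<close>.  What matters later is that the bound on the norm is the same
  for all \<open>U\<close> and \<open>T\<close>: it is used for column spaces that vary without any continuity.\<close>
lemma partial_isometry_between_subspaces:
  fixes U :: "(real^'m) set" and T :: "(real^'k) set"
  assumes U: "subspace U" and T: "subspace T" and le: "dim U \<le> dim T"
  obtains F :: "real^'m^'k" where "norm F \<le> CARD('m)" "range ((*v) F) \<subseteq> T"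
    "\<And>x. x \<in> U \<Longrightarrow> transpose F *v (F *v x) = x"
proof -
  obtain B where B: "B \<subseteq> U" "pairwise orthogonal B" "\<And>x. x \<in> B \<Longrightarrow> norm x = 1"
    "independent B" "card B = dim U" "span B = U"
    using orthonormal_basis_subspace[OF U] by metis
  obtain C where C: "C \<subseteq> T" "pairwise orthogonal C" "\<And>x. x \<in> C \<Longrightarrow> norm x = 1"
    "independent C" "card C = dim T"
    using orthonormal_basis_subspace[OF T] by metis
  have finB: "finite B" and finC: "finite C"
    using B(4) C(4) by (auto intro: independent_imp_finite)
  obtain h where h: "h ` B \<subseteq> C" "inj_on h B"
    using card_le_inj[OF finB finC] le B(5) C(5) by auto
  have Bin: "b \<bullet> b' = (if b = b' then 1 else 0)" if "b \<in> B" "b' \<in> B" for b b'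
    using that B(2,3) by (auto simp: pairwise_def orthogonal_def dot_square_norm)
  have hin: "h b \<bullet> h b' = (if b = b' then 1 else 0)" if "b \<in> B" "b' \<in> B" for b b'
    using that C(2,3) h by (auto simp: pairwise_def orthogonal_def dot_square_norm inj_on_eq_iff image_subset_iff)
  define F :: "real^'m^'k" where "F = (\<Sum>b\<in>B. outer (h b) b)"
  have Fx: "F *v x = (\<Sum>b\<in>B. (b \<bullet> x) *\<^sub>R h b)" for x
    unfolding F_def
    by (simp add: bounded_bilinear.sum_left[OF bounded_bilinear_matrix_vector_mult] outer_vector_mult)
  have trF: "transpose F = (\<Sum>b\<in>B. outer b (h b))"
    unfolding F_def using finB
    by (induction B rule: finite_induct) (auto simp: transpose_zero transpose_add transpose_outer)
  have Fty: "transpose F *v y = (\<Sum>b\<in>B. (h b \<bullet> y) *\<^sub>R b)" for y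
    unfolding trF
    by (simp add: bounded_bilinear.sum_left[OF bounded_bilinear_matrix_vector_mult] outer_vector_mult)
  show ?thesis
  proof
    have "norm F \<le> (\<Sum>b\<in>B. norm (outer (h b) b))"
      unfolding F_def by (rule norm_sum)
    also have "\<dots> = (\<Sum>b\<in>B. 1)"
      using B(3) C(3) h by (intro sum.cong) (auto simp: norm_outer image_subset_iff)
    also have "\<dots> \<le> CARD('m)"
      using B(5) dim_subset_UNIV_cart[of U] by simp
    finally show "norm F \<le> CARD('m)" .
    show "range ((*v) F) \<subseteq> T"
      using h(1) C(1) by (auto simp: Fx intro!: subspace_sum[OF T] subspace_scale[OF T])
    fix x assume "x \<in> U"
    then have x: "x \<in> span B" using B(6) by simp
    have "transpose F *v (F *v b) = b" if "b \<in> B" for b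
    proof -
      have "F *v b = h b"
        using that finB by (simp add: Fx Bin if_distrib[of "\<lambda>c. c *\<^sub>R _"] cong: if_cong)
      then show ?thesis
        using that finB by (simp add: Fty hin if_distrib[of "\<lambda>c. c *\<^sub>R _"] cong: if_cong del: transpose_matrix_vector)
    qed
    then show "transpose F *v (F *v x) = x"
      using linear_eq_on_span[of "\<lambda>x. transpose F *v (F *v x)" "\<lambda>x. x" B x] x
      by (simp add: matrix_vector_mul_assoc linear_id[unfolded id_def] del: transpose_matrix_vector)
  qed
qed

section \<open>Injective and surjective corrections of the factors\<close>

text \<open>A correction \<open>V\<close> with \<open>V ** W2 = 0\<close> does not change the product, which has the rank of \<open>W2\<close>
  once its left factor is injective.  Conversely take \<open>V = J ** (mat 1 - E)\<close>, where
  \<open>E = W2 ** G ** W1\<close> fixes \<open>C(W2)\<close> and kills \<open>N(W1)\<close>, and \<open>J\<close> embeds \<open>N(W1)\<close> isometrically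
  into the orthogonal complement of \<open>C(W1)\<close>.  By orthogonality \<open>(W1 + V) x = 0\<close> forces \<open>W1 x = 0\<close> and
  \<open>V x = 0\<close> separately; then \<open>E x = 0\<close>, so \<open>J x = 0\<close>, so \<open>x = 0\<close>.\<close>
lemma full_column_rank_correction_iff:
  fixes W1 :: "real^'k^'m" and W2 :: "real^'n^'k"
  assumes le: "CARD('k) \<le> CARD('m)"
  shows "(\<exists>V. V ** W2 = 0 \<and> full_column_rank (W1 + V)) \<longleftrightarrow> rank (W1 ** W2) = rank W2"
proof
  assume "\<exists>V. V ** W2 = 0 \<and> full_column_rank (W1 + V)"
  then obtain V where V: "V ** W2 = 0" "inj ((*v) (W1 + V))"
    by (auto simp: full_column_rank_def full_rank_injective)
  have prod: "(W1 + V) ** W2 = W1 ** W2"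
    using V(1) by (simp add: bounded_bilinear.add_left[OF bounded_bilinear_matrix_mult])
  have "null_space ((W1 + V) ** W2) = null_space W2"
    using V(2) by (auto simp: null_space_def inj_def simp flip: matrix_vector_mul_assoc)
  then show "rank (W1 ** W2) = rank W2"
    by (metis prod rank_mult_eq_right_iff)
next
  assume rk: "rank (W1 ** W2) = rank W2"
  obtain G where "W1 ** W2 ** G ** (W1 ** W2) = W1 ** W2"
    by (rule matrix_generalized_inverse)
  then have "W2 ** (G ** (W1 ** W2)) = W2"
    by (intro matrix_cancel_left_factor[OF rk]) (simp add: matrix_mul_assoc)
  then have EW: "W2 ** G ** W1 ** W2 = W2"
    by (simp add: matrix_mul_assoc)
  define E where "E = W2 ** G ** W1"
  define T where "T = {y \<in> UNIV. \<forall>x \<in> column_space W1. orthogonal x y}"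
  have T: "subspace T"
    unfolding T_def by (simp add: subspace_orthogonal_to_vectors)
  have "dim T + rank W1 = CARD('m)"
    unfolding T_def using dim_subspace_orthogonal_to_vectors[of "column_space W1" UNIV]
    by (simp add: subspace_column_space dim_column_space)
  then have "dim (null_space W1) \<le> dim T"
    using dim_null_space[of W1] le by simp
  then obtain J :: "real^'k^'m" where J: "range ((*v) J) \<subseteq> T"
      "\<And>x. x \<in> null_space W1 \<Longrightarrow> transpose J *v (J *v x) = x"
    using partial_isometry_between_subspaces[OF subspace_null_space T] by metis
  define V where "V = J ** (mat 1 - E)"
  have "V ** W2 = J ** (W2 - E ** W2)"
    by (simp add: V_def matrix_diff_rdistrib flip: matrix_mul_assoc)
  then have "V ** W2 = 0"
    by (simp add: E_def EW matrix_zero_right)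
  moreover have "x = 0" if x: "(W1 + V) *v x = 0" for x
  proof -
    have Vx: "V *v x = J *v (x - E *v x)"
      by (simp add: V_def algebra_simps flip: matrix_vector_mul_assoc)
    have sum: "W1 *v x + V *v x = 0" using x by (simp add: algebra_simps)
    have "V *v x \<in> T" using J(1) Vx by auto
    then have "(W1 *v x) \<bullet> (V *v x) = 0"
      by (auto simp: T_def column_space_eq_range orthogonal_def)
    then have "(W1 *v x) \<bullet> (W1 *v x + V *v x) = (W1 *v x) \<bullet> (W1 *v x)"
      by (simp add: inner_add_right)
    then have W1x: "W1 *v x = 0" using sum by simp
    then have "E *v x = 0" by (simp add: E_def flip: matrix_vector_mul_assoc)
    then have "J *v x = 0" using sum W1x Vx by simp
    then show "x = 0" using J(2)[of x] W1x by (simp add: null_space_def)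
  qed
  then have "full_column_rank (W1 + V)"
    unfolding full_column_rank_def full_rank_injective
    by (subst linear_injective_0) auto
  ultimately show "\<exists>V. V ** W2 = 0 \<and> full_column_rank (W1 + V)" by blast
qed

lemma full_row_rank_correction_iff:
  fixes W1 :: "real^'k^'m" and W2 :: "real^'n^'k"
  assumes le: "CARD('k) \<le> CARD('n)"
  shows "(\<exists>V. W1 ** V = 0 \<and> full_row_rank (W2 + V)) \<longleftrightarrow> rank (W1 ** W2) = rank W1"
proof -
  have "(\<exists>V. W1 ** V = 0 \<and> full_row_rank (W2 + V)) \<longleftrightarrow>
      (\<exists>V. V ** transpose W1 = 0 \<and> full_column_rank (transpose W2 + V))" (is "(\<exists>V. ?P V) \<longleftrightarrow> (\<exists>V. ?Q V)")
  proof -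
    have PQ: "?P V \<longleftrightarrow> ?Q (transpose V)" for V
      by (metis full_column_rank_def full_row_rank_def matrix_transpose_mul rank_transpose
          transpose_add transpose_zero transpose_iff)
    show ?thesis by (metis PQ transpose_transpose)
  qed
  also have "\<dots> \<longleftrightarrow> rank (transpose W2 ** transpose W1) = rank (transpose W1)"
    by (rule full_column_rank_correction_iff[OF le])
  finally show ?thesis
    by (metis matrix_transpose_mul rank_transpose)
qed

section \<open>Necessity of the rank conditions\<close>

text \<open>Add a small multiple of \<open>outer u v\<close> with \<open>u\<close> outside the column space and \<open>v\<close> in the null space
  of \<open>A\<close>, so that exactly the direction \<open>v\<close> leaves the null space.  Since \<open>y\<close> has to stay in it, \<open>v\<close> is
  chosen orthogonal to \<open>y\<close>; this needs a null space of dimension at least 2, whence the bound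
  \<open>rank A + 1 < n\<close>.\<close>
lemma rank_one_perturbation_increases_rank:
  fixes A :: "real^'n^'m" and y :: "real^'n"
  assumes y: "A *v y = 0" "y \<noteq> 0" and rk: "rank A < CARD('m)" "rank A + 1 < CARD('n)" and e: "0 < e"
  obtains Z :: "real^'n^'m" where "dist Z A < e" "Z *v y = 0" "rank Z = rank A + 1"
proof -
  have "column_space A \<noteq> UNIV"
    using rk(1) dim_column_space[of A] by auto
  then obtain u where u: "u \<notin> column_space A" by auto
  have "u \<noteq> 0"
    using u subspace_0[OF subspace_column_space] by metis
  have "span {y} \<subseteq> span (null_space A)"
    using y by (intro span_mono) (simp add: null_space_def)
  moreover have "span {y} \<noteq> span (null_space A)"
  proof
    assume "span {y} = span (null_space A)"
    then have "dim {y} = dim (null_space A)" by (metis dim_span)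
    moreover have "dim {y} \<le> 1" by (simp add: dim_insert)
    ultimately show False using dim_null_space[of A] rk(2) by simp
  qed
  ultimately have "span {y} \<subset> span (null_space A)" by blast
  then obtain v where v: "v \<noteq> 0" "v \<in> span (null_space A)" "\<And>w. w \<in> span {y} \<Longrightarrow> orthogonal v w"
    using orthogonal_to_subspace_exists_gen by blast
  have Av: "v \<in> null_space A"
    using v(2) subspace_null_space span_eq_iff by metis
  have vy: "v \<bullet> y = 0"
    using v(3)[of y] by (simp add: span_base orthogonal_def)
  define c where "c = e / (2 * (norm u * norm v))"
  have c: "c > 0"
    using e \<open>u \<noteq> 0\<close> v(1) by (simp add: c_def)
  define Z where "Z = A + c *\<^sub>R outer u v"
  have Zx: "Z *v x = A *v x + (c * (v \<bullet> x)) *\<^sub>R u" for x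
    by (simp add: Z_def algebra_simps outer_vector_mult flip: scaleR_matrix_vector_assoc)
  have "null_space Z = {x \<in> null_space A. \<forall>w\<in>{v}. orthogonal w x}"
  proof (intro equalityI subsetI)
    fix x assume "x \<in> null_space Z"
    then have Z0: "A *v x + (c * (v \<bullet> x)) *\<^sub>R u = 0" by (simp add: null_space_def Zx)
    have "v \<bullet> x = 0"
    proof (rule ccontr)
      assume nz: "v \<bullet> x \<noteq> 0"
      have "A *v (- x) = - (A *v x)"
        using matrix_vector_mult_diff_distrib[of A 0 x] by simp
      then have "(c * (v \<bullet> x)) *\<^sub>R u = A *v (- x)"
        using Z0 by (metis add_eq_0_iff)
      then have "(c * (v \<bullet> x)) *\<^sub>R u \<in> column_space A"
        by (simp add: column_space_eq_range)
      then have "inverse (c * (v \<bullet> x)) *\<^sub>R ((c * (v \<bullet> x)) *\<^sub>R u) \<in> column_space A"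
        by (rule subspace_scale[OF subspace_column_space])
      moreover have "c * (v \<bullet> x) \<noteq> 0" using nz c by simp
      ultimately show False using u by (metis scaleR_scaleR left_inverse scaleR_one)
    qed
    then show "x \<in> {x \<in> null_space A. \<forall>w\<in>{v}. orthogonal w x}"
      using Z0 by (simp add: null_space_def orthogonal_def)
  qed (auto simp: null_space_def Zx orthogonal_def)
  also have "\<dots> = {x \<in> null_space A. \<forall>w\<in>span {v}. orthogonal w x}"
    using span_base[of v "{v}"] by (auto simp: span_singleton orthogonal_def)
  finally have "dim (null_space Z) + dim (span {v}) = dim (null_space A)"
    using dim_subspace_orthogonal_to_vectors[of "span {v}" "null_space A"] Av
    by (simp add: subspace_null_space span_minimal)
  moreover have "dim (span {v}) = 1" using v(1) by (simp add: dim_insert)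
  ultimately have "rank Z = rank A + 1"
    using dim_null_space[of A] dim_null_space[of Z] by simp
  moreover have "dist Z A < e"
    using e c \<open>u \<noteq> 0\<close> v(1) by (simp add: Z_def dist_norm norm_outer) (simp add: c_def field_simps)
  moreover have "Z *v y = 0" by (simp add: Zx y vy)
  ultimately show ?thesis using that by blast
qed

lemma approximation_of_prescribed_rank:
  fixes A :: "real^'n^'m" and y :: "real^'n"
  assumes y: "A *v y = 0" "y \<noteq> 0" and rk: "rank A \<le> r" "r \<le> CARD('m)" "r < CARD('n)" and e: "0 < e"
  shows "\<exists>Z :: real^'n^'m. dist Z A < e \<and> Z *v y = 0 \<and> rank Z = r"
  using rk e
proof (induction r arbitrary: e rule: dec_induct)
  case base
  then show ?case using y by (intro exI[of _ A]) simp
next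
  case (step r)
  obtain B :: "real^'n^'m" where B: "dist B A < e / 2" "B *v y = 0" "rank B = r"
    using step.IH[of "e / 2"] step.prems by auto
  obtain Z :: "real^'n^'m" where "dist Z B < e / 2" "Z *v y = 0" "rank Z = rank B + 1"
    using rank_one_perturbation_increases_rank[of B y "e / 2"] B y step.prems by auto
  moreover from this B have "dist Z A < e"
    using dist_triangle[of Z A B] by simp
  ultimately show ?case using B(3) by auto
qed

text \<open>Unfolded form of local openness in which membership in the range has become a rank bound; the
  bounds by \<open>m\<close> and \<open>n\<close> hold for every matrix of that shape.\<close>
lemma locally_open_at_mat_mult_iff:
  fixes W1 :: "real^'k^'m" and W2 :: "real^'n^'k"
  shows "locally_open_at mat_mult_map (W1, W2) \<longleftrightarrow>
    (\<forall>\<epsilon>>0. \<exists>\<delta>>0. \<forall>Z. dist Z (W1 ** W2) < \<delta> \<longrightarrow> rank Z \<le> CARD('k) \<longrightarrow>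
      (\<exists>X Y. dist (X, Y) (W1, W2) < \<epsilon> \<and> Z = X ** Y))"
proof -
  have 1: "Z \<in> range (mat_mult_map :: (real^'k^'m) \<times> (real^'n^'k) \<Rightarrow> _) \<longleftrightarrow> rank Z \<le> CARD('k)" for Z
    using rank_bound[of Z] by (auto simp: range_mat_mult_map)
  have 2: "Z \<in> mat_mult_map ` ball (W1, W2) \<epsilon> \<longleftrightarrow>
      (\<exists>X Y. dist (X, Y) (W1, W2) < \<epsilon> \<and> Z = X ** Y)" for Z \<epsilon>
    by (force simp: mat_mult_map_def dist_commute)
  have 3: "mat_mult_map (W1, W2) = W1 ** W2" by (simp add: mat_mult_map_def)
  show ?thesis
    unfolding locally_open_at_def subset_iff Int_iff 1 2 3 mem_ball dist_commute[of "W1 ** W2"]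
    by blast
qed

text \<open>A vector \<open>y\<close> with \<open>W1 (W2 y) = 0\<close> but \<open>W2 y \<noteq> 0\<close> obstructs openness: a nearby factorization
  of a matrix that kills \<open>y\<close> has a left factor with nontrivial kernel, so it cannot reach matrices of
  rank \<open>k\<close>.\<close>
lemma locally_open_at_imp_rank_product_eq_right:
  fixes W1 :: "real^'k^'m" and W2 :: "real^'n^'k"
  assumes k: "CARD('k) \<le> CARD('m)" "CARD('k) < CARD('n)"
    and lo: "locally_open_at mat_mult_map (W1, W2)"
  shows "rank (W1 ** W2) = rank W2"
proof (rule ccontr)
  assume ne: "rank (W1 ** W2) \<noteq> rank W2"
  have le: "rank (W1 ** W2) \<le> CARD('k)"
    using rank_mul_le_right[of W1 W2] rank_bound[of W2] by simp
  have "null_space W2 \<subseteq> null_space (W1 ** W2)"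
    by (auto simp: null_space_def simp flip: matrix_vector_mul_assoc)
  then obtain y where y: "(W1 ** W2) *v y = 0" "W2 *v y \<noteq> 0"
    using ne unfolding rank_mult_eq_right_iff by (auto simp: null_space_def)
  then have "y \<noteq> 0" by auto
  have "((\<lambda>Y. Y *v y) \<longlongrightarrow> W2 *v y) (nhds W2)"
    by (intro bounded_bilinear.tendsto[OF bounded_bilinear_matrix_vector_mult] tendsto_const filterlim_ident)
  then have "eventually (\<lambda>Y. Y *v y \<noteq> 0) (nhds W2)"
    by (rule tendsto_imp_eventually_ne) (rule y(2))
  then obtain \<epsilon> where \<epsilon>: "\<epsilon> > 0" "\<And>Y. dist Y W2 < \<epsilon> \<Longrightarrow> Y *v y \<noteq> 0"
    unfolding eventually_nhds_metric by auto
  obtain \<delta> where \<delta>: "\<delta> > 0"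
    "\<And>Z. dist Z (W1 ** W2) < \<delta> \<Longrightarrow> rank Z \<le> CARD('k) \<Longrightarrow>
      \<exists>X Y. dist (X, Y) (W1, W2) < \<epsilon> \<and> Z = X ** Y"
    using lo \<epsilon>(1) unfolding locally_open_at_mat_mult_iff by blast
  obtain Z :: "real^'n^'m" where Z: "dist Z (W1 ** W2) < \<delta>" "Z *v y = 0" "rank Z = CARD('k)"
    using approximation_of_prescribed_rank[OF y(1) \<open>y \<noteq> 0\<close> le k \<delta>(1)] by blast
  obtain X Y where XY: "dist (X, Y) (W1, W2) < \<epsilon>" "Z = X ** Y"
    using \<delta>(2)[OF Z(1)] Z(3) by auto
  have "dist Y W2 < \<epsilon>"
    using XY(1) dist_snd_le[of "(X, Y)" "(W1, W2)"] by simp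
  then have "Y *v y \<noteq> 0" by (rule \<epsilon>(2))
  moreover have "X *v (Y *v y) = 0" using Z(2) XY(2) by (simp add: matrix_vector_mul_assoc)
  ultimately have "\<not> inj ((*v) X)"
    by (metis injD matrix_vector_mult_0_right)
  then have "rank X < CARD('k)" by (simp add: less_rank_noninjective)
  then show False using Z(3) XY(2) rank_mul_le_left[of X Y] by simp
qed

lemma locally_open_at_transpose:
  fixes W1 :: "real^'k^'m" and W2 :: "real^'n^'k"
  assumes lo: "locally_open_at mat_mult_map (W1, W2)"
  shows "locally_open_at mat_mult_map (transpose W2, transpose W1)"
  unfolding locally_open_at_mat_mult_iff
proof (intro allI impI)
  have dist_tr: "dist (transpose A) (transpose B) = dist A B" for A B :: "real^'a^'b"
    by (simp add: dist_norm norm_transpose flip: transpose_diff)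
  fix \<epsilon> :: real assume "\<epsilon> > 0"
  then obtain \<delta> where \<delta>: "\<delta> > 0"
    "\<And>Z. dist Z (W1 ** W2) < \<delta> \<Longrightarrow> rank Z \<le> CARD('k) \<Longrightarrow>
      \<exists>X Y. dist (X, Y) (W1, W2) < \<epsilon> \<and> Z = X ** Y"
    using lo unfolding locally_open_at_mat_mult_iff by blast
  have "\<exists>X Y. dist (X, Y) (transpose W2, transpose W1) < \<epsilon> \<and> Z = X ** Y"
    if Z: "dist Z (transpose W2 ** transpose W1) < \<delta>" "rank Z \<le> CARD('k)" for Z
  proof -
    have "dist (transpose Z) (W1 ** W2) < \<delta>"
      using Z(1) dist_tr[of "transpose Z" "W1 ** W2"] by (simp add: matrix_transpose_mul)
    then obtain X Y where XY: "dist (X, Y) (W1, W2) < \<epsilon>" "transpose Z = X ** Y"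
      using \<delta>(2)[of "transpose Z"] Z(2) by (auto simp: rank_transpose)
    have "dist (transpose Y, transpose X) (transpose W2, transpose W1) < \<epsilon>"
      using XY(1) by (simp add: dist_Pair_Pair dist_tr add.commute)
    moreover have "Z = transpose Y ** transpose X"
      by (metis XY(2) matrix_transpose_mul transpose_transpose)
    ultimately show ?thesis by blast
  qed
  then show "\<exists>\<delta>>0. \<forall>Z. dist Z (transpose W2 ** transpose W1) < \<delta> \<longrightarrow> rank Z \<le> CARD('k) \<longrightarrow>
      (\<exists>X Y. dist (X, Y) (transpose W2, transpose W1) < \<epsilon> \<and> Z = X ** Y)"
    using \<delta>(1) by blast
qed

section \<open>Sufficiency of the rank conditions\<close>

lemma matrix_inv_invertible:
  fixes A :: "real^'n^'n"
  assumes "invertible A"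
  shows "A ** matrix_inv A = mat 1" and "matrix_inv A ** A = mat 1"
  using someI_ex[OF assms[unfolded invertible_def]] by (simp_all add: matrix_inv_def)

text \<open>A Neumann-type estimate: where \<open>f z\<close> is within \<open>1 / (2 K)\<close> of the identity, multiplication by
  \<open>mat 1 - f z\<close> at least halves norms.  Here \<open>K\<close> is a constant for the boundedness of the matrix
  product.\<close>
lemma tendsto_matrix_inv_mat_1:
  fixes f :: "'a \<Rightarrow> real^'n^'n"
  assumes f: "(f \<longlongrightarrow> mat 1) \<F>"
  shows "eventually (\<lambda>z. invertible (f z)) \<F>" and "((\<lambda>z. matrix_inv (f z)) \<longlongrightarrow> mat 1) \<F>"
proof -
  obtain K where K: "K > 0"
    "\<And>(A :: real^'n^'n) (B :: real^'n^'n). norm (A ** B) \<le> norm A * norm B * K"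
    using bounded_bilinear.pos_bounded[OF bounded_bilinear_matrix_mult] by metis
  have small: "eventually (\<lambda>z. norm (f z - mat 1) < 1 / (2 * K)) \<F>"
    using f K(1) by (auto simp: tendsto_iff dist_norm)
  have half: "norm (X ** (mat 1 - f z)) \<le> norm X / 2" "norm ((mat 1 - f z) ** X) \<le> norm X / 2"
    if z: "norm (f z - mat 1) < 1 / (2 * K)" for z and X :: "real^'n^'n"
  proof -
    have "norm X * (norm (mat 1 - f z) * K) \<le> norm X * (1 / 2)"
      using z K(1) by (intro mult_left_mono) (simp_all add: norm_minus_commute field_simps)
    then show "norm (X ** (mat 1 - f z)) \<le> norm X / 2" "norm ((mat 1 - f z) ** X) \<le> norm X / 2"
      using K(2)[of X "mat 1 - f z"] K(2)[of "mat 1 - f z" X] by (simp_all add: ac_simps)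
  qed
  have inv: "invertible (f z)" if z: "norm (f z - mat 1) < 1 / (2 * K)" for z
  proof -
    have "x = 0" if "f z *v x = 0" for x
    proof -
      \<comment> \<open>The vector \<open>x\<close> is encoded as the matrix \<open>outer x x\<close> to make the halving estimate applicable.\<close>
      have "(mat 1 - f z) ** outer x x = outer x x"
        using that by (simp add: matrix_eq outer_vector_mult algebra_simps flip: matrix_vector_mul_assoc)
      then have "norm (outer x x) \<le> 0" using half(2)[OF z, of "outer x x"] by simp
      then show "x = 0" using mult_nonneg_nonneg[of "norm x" "norm x"] by (simp add: norm_outer order_antisym_conv)
    qed
    then show ?thesis
      by (simp add: invertible_left_inverse matrix_left_invertible_ker)
  qed
  show "eventually (\<lambda>z. invertible (f z)) \<F>"
    using small by eventually_elim (rule inv)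
  have bound: "norm (matrix_inv (f z) - mat 1) \<le> norm (f z - mat 1) * (2 * norm (mat 1 :: real^'n^'n) * K)"
    if z: "norm (f z - mat 1) < 1 / (2 * K)" for z
  proof -
    let ?I = "matrix_inv (f z)"
    have "?I ** f z = mat 1"
      using inv[OF z] by (rule matrix_inv_invertible)
    then have eq: "?I - mat 1 = ?I ** (mat 1 - f z)"
      by (simp add: matrix_diff_ldistrib)
    have "norm ?I \<le> norm (mat 1 :: real^'n^'n) + norm (?I - mat 1)"
      using norm_triangle_ineq[of "mat 1" "?I - mat 1"] by simp
    then have "norm ?I \<le> 2 * norm (mat 1 :: real^'n^'n)"
      using half(1)[OF z, of ?I] unfolding eq by simp
    then have "norm (f z - mat 1) * (norm ?I * K) \<le> norm (f z - mat 1) * (2 * norm (mat 1 :: real^'n^'n) * K)"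
      using K(1) by (intro mult_left_mono mult_right_mono) auto
    then show ?thesis
      using K(2)[of ?I "mat 1 - f z"] unfolding eq by (simp add: norm_minus_commute ac_simps)
  qed
  have "((\<lambda>z. norm (f z - mat 1)) \<longlongrightarrow> 0) \<F>"
    using f by (simp add: tendsto_norm_zero_iff Lim_null[symmetric] LIM_zero_iff)
  then have "((\<lambda>z. norm (f z - mat 1) * (2 * norm (mat 1 :: real^'n^'n) * K)) \<longlongrightarrow> 0) \<F>"
    by (rule tendsto_mult_left_zero)
  then have "((\<lambda>z. matrix_inv (f z) - mat 1) \<longlongrightarrow> 0) \<F>"
    by (rule Lim_null_comparison[rotated]) (use small bound in \<open>auto elim: eventually_mono\<close>)
  then show "((\<lambda>z. matrix_inv (f z)) \<longlongrightarrow> mat 1) \<F>"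
    by (simp add: LIM_zero_iff)
qed

text \<open>In block form with respect to \<open>E\<close> this is the additivity of the rank under block elimination:
  \<open>L ** Z ** R\<close> is an invertible pivot block of size \<open>rank E\<close> and \<open>S\<close> its Schur complement.  Without
  blocks: \<open>L\<close> annihilates \<open>S\<close> but is injective on the column space of \<open>Z ** R\<close>, hence the column spaces of
  \<open>S\<close> and \<open>Z ** R\<close>, both contained in that of \<open>Z\<close>, are independent.\<close>
lemma rank_schur_complement_le:
  fixes Z S :: "real^'n^'m" and E D D' :: "real^'k^'k" and L :: "real^'m^'k" and R :: "real^'k^'n"
  assumes E: "E ** E = E" "E ** L = L" "R ** E = R"
    and D: "D = L ** Z ** R + (mat 1 - E)" "D ** D' = mat 1" "D' ** D = mat 1"
    and S: "S = Z - Z ** R ** D' ** L ** Z"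
  shows "rank S + rank E \<le> rank Z"
proof -
  let ?P = "Z ** R"
  have DE: "D ** E = L ** Z ** R" and ED: "E ** D = L ** Z ** R"
    using E by (simp_all add: D(1) matrix_add_ldistrib matrix_diff_ldistrib matrix_diff_rdistrib
        bounded_bilinear.add_left[OF bounded_bilinear_matrix_mult] matrix_mul_assoc)
      (simp_all flip: matrix_mul_assoc)
  have "E = D' ** (L ** ?P)"
    using DE D(3) by (metis matrix_mul_assoc matrix_mul_lid)
  then have rE: "rank E \<le> rank ?P"
    using rank_mul_le_right by (metis order_trans)
  have "L ** Z ** R ** D' ** L ** Z = E ** D ** D' ** L ** Z"
    by (simp add: ED)
  also have "\<dots> = L ** Z"
    using D(2) E(2) by (metis matrix_mul_assoc matrix_mul_rid)
  finally have LS: "L ** S = 0"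
    by (simp add: S matrix_diff_ldistrib matrix_mul_assoc)
  have "column_space S \<inter> column_space ?P \<subseteq> {0}"
  proof
    fix y assume "y \<in> column_space S \<inter> column_space ?P"
    then obtain x w where y: "y = S *v x" "y = ?P *v w"
      unfolding column_space_eq_range by blast
    have "E *v w = D' *v (L *v y)"
      unfolding y(2) matrix_vector_mul_assoc using \<open>E = D' ** (L ** ?P)\<close> by (simp add: matrix_mul_assoc)
    also have "L *v y = 0"
      unfolding y(1) matrix_vector_mul_assoc LS by simp
    finally have Ew: "E *v w = 0" by simp
    have "?P *v w = (Z ** R) *v (E *v w)"
      using E(3) by (metis matrix_mul_assoc matrix_vector_mul_assoc)
    then show "y \<in> {0}" using Ew y(2) by simp
  qed
  then have "dim (column_space S \<inter> column_space ?P) = 0" by simp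
  then have "rank S + rank ?P = dim {a + b |a b. a \<in> column_space S \<and> b \<in> column_space ?P}"
    using dim_sums_Int[OF subspace_column_space subspace_column_space, of S ?P]
    by (simp only: dim_column_space add_0_right)
  also have "\<dots> \<le> dim (column_space Z)"
  proof (rule dim_subset)
    have "S = Z ** (mat 1 - R ** D' ** L ** Z)"
      by (simp add: S matrix_diff_ldistrib matrix_mul_assoc)
    then have "column_space S \<subseteq> column_space Z"
      by (auto simp: column_space_eq_range simp flip: matrix_vector_mul_assoc)
    moreover have "column_space ?P \<subseteq> column_space Z"
      by (auto simp: column_space_eq_range simp flip: matrix_vector_mul_assoc)
    ultimately show "{a + b |a b. a \<in> column_space S \<and> b \<in> column_space ?P} \<subseteq> column_space Z"
      using subspace_add[OF subspace_column_space] by blast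
  qed
  finally show ?thesis using rE by (simp add: dim_column_space)
qed

text \<open>The column space of \<open>S\<close> has dimension at most \<open>k - rank E = dim N(E)\<close>, so a partial isometry \<open>F\<close>
  into \<open>N(E)\<close> factors \<open>S\<close> as \<open>F\<^sup>T (1 - E)\<close> times \<open>F S\<close>.  The first of these factors kills the
  column space of \<open>E\<close> and the second maps into the null space of \<open>E\<close>, so the mixed terms in the product
  vanish.  The parameter \<open>t\<close> distributes the norm of \<open>S\<close> among the factors.\<close>
lemma factorisation_via_schur_complement:
  fixes Z S :: "real^'n^'m" and E D D' :: "real^'k^'k" and L :: "real^'m^'k" and R :: "real^'k^'n"
  assumes E: "E ** E = E" "E ** L = L" "R ** E = R"
    and D: "D = L ** Z ** R + (mat 1 - E)" "D ** D' = mat 1" "D' ** D = mat 1"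
    and S: "S = Z - Z ** R ** D' ** L ** Z"
    and rk: "rank Z \<le> CARD('k)"
  obtains F :: "real^'m^'k" where "norm F \<le> CARD('m)"
    "\<And>t. t \<noteq> 0 \<or> S = 0 \<Longrightarrow>
      (Z ** R ** D' + t *\<^sub>R (transpose F ** (mat 1 - E))) ** (L ** Z + (1 / t) *\<^sub>R (F ** S)) = Z"
proof -
  have "rank S + rank E \<le> rank Z"
    by (rule rank_schur_complement_le[OF E D S])
  then have "dim (column_space S) \<le> dim (null_space E)"
    using dim_null_space[of E] rk by (simp add: dim_column_space)
  then obtain F :: "real^'m^'k" where F: "norm F \<le> CARD('m)" "range ((*v) F) \<subseteq> null_space E"
    "\<And>x. x \<in> column_space S \<Longrightarrow> transpose F *v (F *v x) = x"
    using partial_isometry_between_subspaces[OF subspace_column_space subspace_null_space] by metis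
  have EF: "E ** F = 0"
    using F(2) by (auto simp: matrix_eq null_space_def simp flip: matrix_vector_mul_assoc)
  have FFS: "transpose F ** F ** S = S"
    using F(3) by (auto simp: matrix_eq column_space_eq_range simp del: transpose_matrix_vector
        simp flip: matrix_vector_mul_assoc)
  have DE: "D ** E = E ** D"
    using E by (simp add: D(1) matrix_add_ldistrib matrix_diff_ldistrib matrix_diff_rdistrib
        bounded_bilinear.add_left[OF bounded_bilinear_matrix_mult] matrix_mul_assoc)
      (simp flip: matrix_mul_assoc)
  have ED': "E ** D' = D' ** E"
    using DE D(2,3) by (metis matrix_mul_assoc matrix_mul_lid matrix_mul_rid)
  have a: "(transpose F ** (mat 1 - E)) ** (L ** Z) = 0"
  proof -
    have "(mat 1 - E) ** L = 0" using E(2) by (simp add: matrix_diff_rdistrib)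
    then show ?thesis by (metis matrix_mul_assoc matrix_zero_left matrix_zero_right)
  qed
  have b: "(Z ** R ** D') ** (F ** S) = 0"
  proof -
    have "R ** D' ** F = R ** E ** D' ** F" by (simp add: E(3))
    also have "\<dots> = R ** D' ** (E ** F)" using ED' by (metis matrix_mul_assoc)
    finally have "R ** D' ** F = 0" by (simp add: EF matrix_zero_right)
    then show ?thesis by (metis matrix_mul_assoc matrix_zero_left matrix_zero_right)
  qed
  have c: "(transpose F ** (mat 1 - E)) ** (F ** S) = S"
  proof -
    have "(mat 1 - E) ** F = F" by (simp add: matrix_diff_rdistrib EF)
    then show ?thesis by (metis FFS matrix_mul_assoc)
  qed
  have "(Z ** R ** D' + t *\<^sub>R (transpose F ** (mat 1 - E))) ** (L ** Z + (1 / t) *\<^sub>R (F ** S)) = Z"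
    if t: "t \<noteq> 0 \<or> S = 0" for t
  proof -
    have "(Z ** R ** D' + t *\<^sub>R (transpose F ** (mat 1 - E))) ** (L ** Z + (1 / t) *\<^sub>R (F ** S))
        = Z ** R ** D' ** L ** Z + (t * (1 / t)) *\<^sub>R S"
      by (simp add: matrix_add_ldistrib bounded_bilinear.add_left[OF bounded_bilinear_matrix_mult]
          matrix_scaleR_left matrix_scaleR_right a b c)
        (simp add: matrix_mul_assoc)
    also have "(t * (1 / t)) *\<^sub>R S = S" using t by auto
    finally show ?thesis by (simp add: S)
  qed
  then show ?thesis using F(1) that by blast
qed

text \<open>At \<open>Z = W1 ** W2\<close> the previous factorization is \<open>(W1, W2)\<close> with \<open>S = 0\<close>.  The factors without
  the additions depend continuously on \<open>Z\<close>; the additions do not, because of \<open>F\<close>, but with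
  \<open>t = sqrt (norm S)\<close> both are of size \<open>O(sqrt (norm S))\<close>.\<close>
lemma rank_product_eq_imp_locally_open_at:
  fixes W1 :: "real^'k^'m" and W2 :: "real^'n^'k"
  assumes rk1: "rank (W1 ** W2) = rank W1" and rk2: "rank (W1 ** W2) = rank W2"
  shows "locally_open_at mat_mult_map (W1, W2)"
proof -
  obtain G where G: "W1 ** W2 ** G ** (W1 ** W2) = W1 ** W2"
    by (rule matrix_generalized_inverse)
  have "W2 ** (G ** (W1 ** W2)) = W2"
    by (intro matrix_cancel_left_factor[OF rk2]) (use G in \<open>simp add: matrix_mul_assoc\<close>)
  moreover have "(W1 ** W2 ** G) ** W1 = W1"
    by (intro matrix_cancel_right_factor[OF rk1]) (rule G)
  moreover define E where "E = W2 ** G ** W1"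
  moreover define L where "L = W2 ** G"
  moreover define R where "R = G ** W1"
  ultimately have W: "E ** W2 = W2" "W1 ** E = W1" "L ** W1 = E" "W2 ** R = E"
    by (simp_all add: matrix_mul_assoc)
  have E: "E ** E = E" "E ** L = L" "R ** E = R"
    using W by (simp_all add: E_def L_def R_def matrix_mul_assoc)
      (simp_all flip: matrix_mul_assoc)
  obtain K1 where K1: "K1 > 0"
    "\<And>(A :: real^'k^'m) (B :: real^'k^'k). norm (A ** B) \<le> norm A * norm B * K1"
    using bounded_bilinear.pos_bounded[OF bounded_bilinear_matrix_mult] by metis
  obtain K2 where K2: "K2 > 0"
    "\<And>(A :: real^'m^'k) (B :: real^'n^'m). norm (A ** B) \<le> norm A * norm B * K2"
    using bounded_bilinear.pos_bounded[OF bounded_bilinear_matrix_mult] by metis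
  define c where "c = CARD('m) * norm (mat 1 - E) * K1 + CARD('m) * K2"
  define D where "D Z = L ** Z ** R + (mat 1 - E)" for Z
  define D' where "D' Z = matrix_inv (D Z)" for Z
  define S where "S Z = Z - Z ** R ** D' Z ** L ** Z" for Z
  define N where "N = nhds (W1 ** W2)"
  have id: "((\<lambda>Z. Z) \<longlongrightarrow> W1 ** W2) N"
    unfolding N_def by (rule filterlim_ident)
  note lims = tendsto_matrix_mult tendsto_const id tendsto_add tendsto_diff
  have "(D \<longlongrightarrow> L ** (W1 ** W2) ** R + (mat 1 - E)) N"
    unfolding D_def by (intro lims)
  moreover have "L ** (W1 ** W2) ** R = E"
    using W E(1) by (metis matrix_mul_assoc)
  ultimately have D: "(D \<longlongrightarrow> mat 1) N" by simp
  note inv = tendsto_matrix_inv_mat_1(1)[OF D]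
  have D': "(D' \<longlongrightarrow> mat 1) N"
    unfolding D'_def by (rule tendsto_matrix_inv_mat_1(2)[OF D])
  have "((\<lambda>Z. Z ** R ** D' Z) \<longlongrightarrow> W1 ** W2 ** R ** mat 1) N"
    by (intro lims D')
  then have P: "((\<lambda>Z. Z ** R ** D' Z) \<longlongrightarrow> W1) N"
    using W by (simp flip: matrix_mul_assoc)
  have "((\<lambda>Z. L ** Z) \<longlongrightarrow> L ** (W1 ** W2)) N"
    by (intro lims)
  then have Q: "((\<lambda>Z. L ** Z) \<longlongrightarrow> W2) N"
    using W by (simp add: matrix_mul_assoc)
  have "((\<lambda>Z. Z - (Z ** R ** D' Z) ** (L ** Z)) \<longlongrightarrow> W1 ** W2 - W1 ** W2) N"
    by (intro tendsto_diff tendsto_matrix_mult[OF P Q] id)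
  then have "(S \<longlongrightarrow> 0) N"
    by (simp add: S_def[abs_def] matrix_mul_assoc)
  then have s: "((\<lambda>Z. sqrt (norm (S Z))) \<longlongrightarrow> 0) N"
    using tendsto_real_sqrt[OF tendsto_norm_zero] by fastforce
  have "((\<lambda>Z. dist (Z ** R ** D' Z) W1 + dist (L ** Z) W2 + sqrt (norm (S Z)) * c)
      \<longlongrightarrow> dist W1 W1 + dist W2 W2 + 0 * c) N"
    by (intro tendsto_add tendsto_mult tendsto_dist P Q s tendsto_const)
  then have err: "((\<lambda>Z. dist (Z ** R ** D' Z) W1 + dist (L ** Z) W2 + sqrt (norm (S Z)) * c) \<longlongrightarrow> 0) N"
    by simp
  show ?thesis
    unfolding locally_open_at_mat_mult_iff
  proof (intro allI impI)
    fix \<epsilon> :: real assume "\<epsilon> > 0"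
    with err have "eventually (\<lambda>Z. dist (Z ** R ** D' Z) W1 + dist (L ** Z) W2 + sqrt (norm (S Z)) * c < \<epsilon>) N"
      by (rule order_tendstoD(2))
    with inv have "eventually (\<lambda>Z. rank Z \<le> CARD('k) \<longrightarrow>
        (\<exists>X Y. dist (X, Y) (W1, W2) < \<epsilon> \<and> Z = X ** Y)) N"
    proof eventually_elim
      case (elim Z)
      show ?case
      proof
        assume rk: "rank Z \<le> CARD('k)"
        have "D Z ** D' Z = mat 1" "D' Z ** D Z = mat 1"
          using elim(1) by (simp_all add: D'_def matrix_inv_invertible)
        then obtain F :: "real^'m^'k" where F: "norm F \<le> CARD('m)"
          "\<And>t. t \<noteq> 0 \<or> S Z = 0 \<Longrightarrow>
            (Z ** R ** D' Z + t *\<^sub>R (transpose F ** (mat 1 - E))) ** (L ** Z + (1 / t) *\<^sub>R (F ** S Z)) = Z"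
          using factorisation_via_schur_complement[OF E D_def _ _ S_def rk] by metis
        define t where "t = sqrt (norm (S Z))"
        have t: "t \<ge> 0" "t \<noteq> 0 \<or> S Z = 0" by (auto simp: t_def)
        define U where "U = t *\<^sub>R (transpose F ** (mat 1 - E))"
        define V where "V = (1 / t) *\<^sub>R (F ** S Z)"
        have "norm U \<le> t * (norm (transpose F) * norm (mat 1 - E) * K1)"
          unfolding U_def using t(1) K1(2)[of "transpose F" "mat 1 - E"] by (simp add: mult_left_mono)
        also have "\<dots> \<le> t * (CARD('m) * norm (mat 1 - E) * K1)"
          using t(1) F(1) K1(1) by (intro mult_left_mono mult_right_mono) (auto simp: norm_transpose)
        finally have U: "norm U \<le> t * (CARD('m) * norm (mat 1 - E) * K1)" .
        have tt: "norm (S Z) = t * t" by (simp add: t_def)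
        \<comment> \<open>For \<open>t = 0\<close> also \<open>S Z = 0\<close>, and the convention \<open>1 / 0 = 0\<close> makes the estimate hold as it stands.\<close>
        have "norm V \<le> (1 / t) * (norm F * norm (S Z) * K2)"
          unfolding V_def using t(1) K2(2)[of F "S Z"] by (simp add: divide_right_mono)
        also have "\<dots> = t * (norm F * K2)"
          using t by (cases "t = 0") (auto simp: tt)
        also have "\<dots> \<le> t * (CARD('m) * K2)"
          using t(1) F(1) K2(1) by (intro mult_left_mono mult_right_mono) auto
        finally have V: "norm V \<le> t * (CARD('m) * K2)" .
        let ?X = "Z ** R ** D' Z + U" and ?Y = "L ** Z + V"
        have "dist (?X, ?Y) (W1, W2) \<le> dist ?X W1 + dist ?Y W2"
          using norm_Pair_le[of "?X - W1" "?Y - W2"] by (simp add: dist_norm)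
        also have "\<dots> \<le> (dist (Z ** R ** D' Z) W1 + norm U) + (dist (L ** Z) W2 + norm V)"
          unfolding dist_norm
          by (intro add_mono) (metis add_diff_eq add.commute diff_add_eq norm_triangle_ineq)+
        also have "\<dots> \<le> dist (Z ** R ** D' Z) W1 + dist (L ** Z) W2 + t * c"
          using U V unfolding c_def distrib_left by linarith
        also have "\<dots> < \<epsilon>" using elim(2) by (simp add: t_def)
        finally have "dist (?X, ?Y) (W1, W2) < \<epsilon>" .
        moreover have "Z = ?X ** ?Y"
          using F(2)[OF t(2)] by (simp add: U_def V_def)
        ultimately show "\<exists>X Y. dist (X, Y) (W1, W2) < \<epsilon> \<and> Z = X ** Y" by blast
      qed
    qed
    then show "\<exists>\<delta>>0. \<forall>Z. dist Z (W1 ** W2) < \<delta> \<longrightarrow> rank Z \<le> CARD('k) \<longrightarrow>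
        (\<exists>X Y. dist (X, Y) (W1, W2) < \<epsilon> \<and> Z = X ** Y)"
      unfolding N_def eventually_nhds_metric .
  qed
qed

section \<open>Characterization of local openness\<close>

theorem theorem8:
  fixes W1 :: "real^'k^'m" and W2 :: "real^'n^'k"
  assumes "CARD('k) < min (CARD('m)) (CARD('n))"
  shows "(rank W1 \<noteq> rank W2 \<longrightarrow> \<not> locally_open_at mat_mult_map (W1, W2)) \<and>
    (rank W1 = rank W2 \<longrightarrow>
      ((\<exists>V1 :: real^'k^'m. V1 ** W2 = 0 \<and> full_column_rank (W1 + V1))
        \<longleftrightarrow> (\<exists>V2 :: real^'n^'k. W1 ** V2 = 0 \<and> full_row_rank (W2 + V2))) \<and>
      ((\<exists>V2 :: real^'n^'k. W1 ** V2 = 0 \<and> full_row_rank (W2 + V2))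
        \<longleftrightarrow> dim (null_space W1 \<inter> column_space W2) = 0) \<and>
      (dim (null_space W1 \<inter> column_space W2) = 0
        \<longleftrightarrow> dim (null_space (transpose W2) \<inter> column_space (transpose W1)) = 0) \<and>
      (dim (null_space (transpose W2) \<inter> column_space (transpose W1)) = 0
        \<longleftrightarrow> locally_open_at mat_mult_map (W1, W2)))"
proof -
  have k: "CARD('k) < CARD('m)" "CARD('k) < CARD('n)"
    using assms by simp_all
  have i: "(\<exists>V1 :: real^'k^'m. V1 ** W2 = 0 \<and> full_column_rank (W1 + V1)) \<longleftrightarrow> rank (W1 ** W2) = rank W2"
    using k by (intro full_column_rank_correction_iff) simp
  have ii: "(\<exists>V2 :: real^'n^'k. W1 ** V2 = 0 \<and> full_row_rank (W2 + V2)) \<longleftrightarrow> rank (W1 ** W2) = rank W1"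
    using k by (intro full_row_rank_correction_iff) simp
  have v: "locally_open_at mat_mult_map (W1, W2) \<longleftrightarrow>
      rank (W1 ** W2) = rank W1 \<and> rank (W1 ** W2) = rank W2"
  proof
    assume lo: "locally_open_at mat_mult_map (W1, W2)"
    have "rank (transpose W2 ** transpose W1) = rank (transpose W1)"
      using k by (intro locally_open_at_imp_rank_product_eq_right locally_open_at_transpose lo) simp_all
    then have "rank (W1 ** W2) = rank W1"
      by (metis matrix_transpose_mul rank_transpose)
    moreover have "rank (W1 ** W2) = rank W2"
      using k by (intro locally_open_at_imp_rank_product_eq_right lo) simp_all
    ultimately show "rank (W1 ** W2) = rank W1 \<and> rank (W1 ** W2) = rank W2" ..
  qed (simp add: rank_product_eq_imp_locally_open_at)
  show ?thesis
    unfolding i ii v rank_mult_eq_left_iff_disjoint rank_mult_eq_right_iff_disjoint[of W1 W2] by auto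
qed

end
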